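(* Let $\mathcal{I}=\mathcal{I}\langle a_j,\varphi_j\rangle_{j<\omega}$ be a somewhere tall fragmented ideal such that every $\varphi_j$ is a measure. Then $\mathcal{I}$ is not gradually fragmented and $\mathfrak{b}(\mathcal{I})=\aleph_1$.
   Context: A submeasure on a finite set $a$ is a map $\varphi:\mathcal{P}(a)\to[0,+\infty)$ with $\varphi(\varnothing)=0$, monotone, finitely subadditive; it is a measure if moreover $\varphi(x\cup y)=\varphi(x)+\varphi(y)$ for disjoint $x,y$. Given a partition $\{a_i\}_{i<\omega}$ of $\omega$ into nonempty finite sets and submeasures $\varphi_i$ on $\mathcal{P}(a_i)$, $\mathcal{I}\langle a_i,\varphi_i\rangle_{i<\omega}=\{x\subseteq\omega: \{\varphi_i(x\cap a_i)\}_{i<\omega}\text{ bounded}\}$ (a fragmented ideal). It is gradually fragmented if for every $k<\omega$ there is $m<\omega$ such that for every $l<\omega$, for all but finitely many $i$, for every $B\subseteq\mathcal{P}(a_i)$ with $|B|\leq l$ and $\varphi_i(b)\leq k$ for all $b\in B$, $\varphi_i(\bigcup B)\leq m$. An ideal $\mathcal{I}$ on $\omega$ is tall if every infinite $X\subseteq\omega$ contains an infinite member of $\mathcal{I}$; for $X\subseteq\omega$, $\mathcal{I}\restriction X=\{Y\in\mathcal{I}:Y\subseteq X\}$; $\mathcal{I}$ is somewhere tall if there is $X\notin\mathcal{I}$ with $\mathcal{I}\restriction X$ tall (as an ideal on $X$). For $A,B\subseteq\omega$, $A\subseteq_{\mathcal{I}}B$ iff $A\smallsetminus B\in\mathcal{I}$.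 A pair $\langle\mathcal{A},\mathcal{B}\rangle$ is $\mathcal{I}$-orthogonal if $A\cap B\in\mathcal{I}$ for all $A\in\mathcal{A},B\in\mathcal{B}$; $C$ separates it if $A\cap C\in\mathcal{I}$ for all $A\in\mathcal{A}$ and $B\subseteq_{\mathcal{I}}C$ for all $B\in\mathcal{B}$; an $\mathcal{I}$-gap is an unseparated $\mathcal{I}$-orthogonal pair. $\mathfrak{b}(\mathcal{I})$ is the least $\lambda$ such that there is an $\mathcal{I}$-gap $\langle\mathcal{A},\mathcal{B}\rangle$ with $|\mathcal{A}|=\aleph_0$, $|\mathcal{B}|=\lambda$. *)

theory Defs
  imports Complex_Main "HOL-Library.Disjoint_Sets"
begin

unbundle cardinal_syntax

definition submeasure_on :: "'a set \<Rightarrow> ('a set \<Rightarrow> real) \<Rightarrow> bool" where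
  "submeasure_on a \<phi> \<longleftrightarrow>
     (\<forall>x. x \<subseteq> a \<longrightarrow> 0 \<le> \<phi> x) \<and>
     \<phi> {} = 0 \<and>
     (\<forall>x y. x \<subseteq> y \<and> y \<subseteq> a \<longrightarrow> \<phi> x \<le> \<phi> y) \<and>
     (\<forall>x y. x \<subseteq> a \<and> y \<subseteq> a \<longrightarrow> \<phi> (x \<union> y) \<le> \<phi> x + \<phi> y)"

definition fin_measure_on :: "'a set \<Rightarrow> ('a set \<Rightarrow> real) \<Rightarrow> bool" where
  "fin_measure_on a \<phi> \<longleftrightarrow>
     submeasure_on a \<phi> \<and>
     (\<forall>x y. x \<subseteq> a \<and> y \<subseteq> a \<and> x \<inter> y = {} \<longrightarrow> \<phi> (x \<union> y) = \<phi> x + \<phi> y)"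

definition fragmentation :: "(nat \<Rightarrow> nat set) \<Rightarrow> (nat \<Rightarrow> nat set \<Rightarrow> real) \<Rightarrow> bool" where
  "fragmentation a \<phi> \<longleftrightarrow>
     (\<forall>i. finite (a i) \<and> a i \<noteq> {}) \<and>
     disjoint_family a \<and> (\<Union>i. a i) = UNIV \<and>
     (\<forall>i. submeasure_on (a i) (\<phi> i))"

definition fragmented_ideal ::
    "(nat \<Rightarrow> nat set) \<Rightarrow> (nat \<Rightarrow> nat set \<Rightarrow> real) \<Rightarrow> nat set set" where
  "fragmented_ideal a \<phi> = {x. Bseq (\<lambda>i. \<phi> i (x \<inter> a i))}"

definition gradually_fragmented ::
    "(nat \<Rightarrow> nat set) \<Rightarrow> (nat \<Rightarrow> nat set \<Rightarrow> real) \<Rightarrow> bool" where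
  "gradually_fragmented a \<phi> \<longleftrightarrow>
     (\<forall>k::nat. \<exists>m::nat. \<forall>l::nat. \<forall>\<^sub>\<infinity>i. \<forall>B.
        B \<subseteq> Pow (a i) \<and> card B \<le> l \<and> (\<forall>b\<in>B. \<phi> i b \<le> real k)
        \<longrightarrow> \<phi> i (\<Union>B) \<le> real m)"

definition tall_on :: "'a set \<Rightarrow> 'a set set \<Rightarrow> bool" where
  "tall_on X J \<longleftrightarrow> (\<forall>Y. Y \<subseteq> X \<and> infinite Y \<longrightarrow> (\<exists>Z\<in>J. infinite Z \<and> Z \<subseteq> Y))"

definition ideal_restrict :: "'a set set \<Rightarrow> 'a set \<Rightarrow> 'a set set" where
  "ideal_restrict J X = {Y \<in> J. Y \<subseteq> X}"

definition somewhere_tall :: "'a set set \<Rightarrow> bool" where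
  "somewhere_tall J \<longleftrightarrow> (\<exists>X. X \<notin> J \<and> tall_on X (ideal_restrict J X))"

definition subset_mod :: "'a set set \<Rightarrow> 'a set \<Rightarrow> 'a set \<Rightarrow> bool" where
  "subset_mod J A B \<longleftrightarrow> A - B \<in> J"

definition orthogonal_mod :: "'a set set \<Rightarrow> 'a set set \<Rightarrow> 'a set set \<Rightarrow> bool" where
  "orthogonal_mod J \<A> \<B> \<longleftrightarrow> (\<forall>A\<in>\<A>. \<forall>B\<in>\<B>. A \<inter> B \<in> J)"

definition separates_mod :: "'a set set \<Rightarrow> 'a set \<Rightarrow> 'a set set \<Rightarrow> 'a set set \<Rightarrow> bool" where
  "separates_mod J C \<A> \<B> \<longleftrightarrow> (\<forall>A\<in>\<A>. A \<inter> C \<in> J) \<and> (\<forall>B\<in>\<B>. subset_mod J B C)"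

definition gap_mod :: "'a set set \<Rightarrow> 'a set set \<Rightarrow> 'a set set \<Rightarrow> bool" where
  "gap_mod J \<A> \<B> \<longleftrightarrow> orthogonal_mod J \<A> \<B> \<and> (\<nexists>C. separates_mod J C \<A> \<B>)"

text \<open>
  HOL has no type of all cardinals, so the invariant \<open>\<bb>(J)\<close> is rendered as a predicate:
  \<open>is_bb J r\<close> says that the cardinal order \<open>r\<close> is, up to order isomorphism, the least
  \<open>\<lambda>\<close> for which there is a \<open>J\<close>-gap \<open>(\<A>, \<B>)\<close> with \<open>\<A>\<close> of size aleph-0 and \<open>\<B>\<close> of size \<open>\<lambda>\<close>.
\<close>

definition is_bb :: "'a set set \<Rightarrow> 'c rel \<Rightarrow> bool" where
  "is_bb J r \<longleftrightarrow> Card_order r \<and>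
     (\<exists>\<A> \<B>. gap_mod J \<A> \<B> \<and> |\<A>| =o natLeq \<and> |\<B>| =o r) \<and>
     (\<forall>\<A> \<B>. gap_mod J \<A> \<B> \<and> |\<A>| =o natLeq \<longrightarrow> r \<le>o |\<B>| )"

end

theory Submission
  imports Defs "HOL-Library.Countable_Set" "HOL-Library.Nat_Bijection"
begin

text \<open>
  Tallness below a positive set \<open>X\<close> forces the point masses on \<open>X\<close> to be bounded by some \<open>K\<close>, so
  subsets of \<open>X \<inter> a i\<close> can be chosen with any prescribed measure up to an error of \<open>K\<close>. Many
  disjoint pieces of bounded measure contradict gradual fragmentation. For the gap, take distinct
  indices \<open>ix n j\<close> and, inside \<open>X \<inter> a (ix n j)\<close>, disjoint pieces \<open>P n j s\<close> of measure between
  \<open>n + 1\<close> and \<open>n + 1 + K\<close> for all \<open>s \<subseteq> {..<j}\<close>. Put \<open>A n = (\<Union>j. a (ix n j))\<close> and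
  \<open>B x = (\<Union>n j. P n j (x \<inter> {..<j}))\<close> for sets \<open>x\<close> of naturals. If \<open>C\<close> separated the \<open>A n\<close> from
  uncountably many \<open>B x\<close>, infinitely many of the sets \<open>B x - C\<close> would be bounded by the same \<open>d\<close>; for
  \<open>n = d\<close> and large \<open>j\<close>, arbitrarily many disjoint pieces would each meet \<open>C\<close> in measure at
  least \<open>1\<close>, so \<open>C \<inter> A d\<close> would be positive. Conversely, countable orthogonal families are always
  separated.
\<close>

section \<open>Fragmented ideals and choices of blocks\<close>

text \<open>An infinite set of naturals has members above any given bound, so the choices can be
  made strictly increasing. This later puts different requirements into different blocks.\<close>

lemma inj_choice_infinite:
  fixes S :: "nat \<Rightarrow> nat set"
  assumes "\<And>p. infinite (S p)"
  obtains r where "inj r" "\<And>p. r p \<in> S p"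
proof -
  have "\<exists>r. \<forall>p. r p \<in> S p \<and> r p < r (Suc p)"
  proof (rule dependent_nat_choice)
    show "\<exists>x. x \<in> S 0"
      using assms[of 0] by (metis ex_in_conv finite.emptyI)
    show "\<exists>y. y \<in> S (Suc p) \<and> x < y" if "x \<in> S p" for x p
      using assms[of "Suc p"] unfolding infinite_nat_iff_unbounded by auto
  qed
  then obtain r where r: "\<And>p. r p \<in> S p" "\<And>p. r p < r (Suc p)" by blast
  then have "strict_mono r" by (simp add: strict_mono_Suc_iff)
  then show ?thesis using r that strict_mono_imp_inj_on by blast
qed

lemma fragmentation_submeasureD:
  assumes "fragmentation a \<phi>"
  shows "x \<subseteq> a i \<Longrightarrow> 0 \<le> \<phi> i x" "\<phi> i {} = 0"
    "x \<subseteq> y \<Longrightarrow> y \<subseteq> a i \<Longrightarrow> \<phi> i x \<le> \<phi> i y"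
    "x \<subseteq> a i \<Longrightarrow> y \<subseteq> a i \<Longrightarrow> \<phi> i (x \<union> y) \<le> \<phi> i x + \<phi> i y"
  using assms by (simp_all add: fragmentation_def submeasure_on_def)

lemma fragmentation_disjoint:
  assumes "fragmentation a \<phi>" "i \<noteq> j"
  shows "a i \<inter> a j = {}"
  using assms unfolding fragmentation_def disjoint_family_on_def by blast

text \<open>Submeasures are nonnegative, so boundedness in norm amounts to an upper bound.\<close>

lemma fragmented_ideal_iff:
  assumes "fragmentation a \<phi>"
  shows "x \<in> fragmented_ideal a \<phi> \<longleftrightarrow> (\<exists>M. \<forall>i. \<phi> i (x \<inter> a i) \<le> M)"
proof -
  have "0 \<le> \<phi> i (x \<inter> a i)" for i
    by (rule fragmentation_submeasureD[OF assms]) auto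
  then show ?thesis
    unfolding fragmented_ideal_def Bseq_def mem_Collect_eq real_norm_def
    by (metis abs_of_nonneg linorder_le_cases order.trans zero_less_one order_less_le_trans)
qed

lemma fragmented_ideal_empty:
  assumes "fragmentation a \<phi>"
  shows "{} \<in> fragmented_ideal a \<phi>"
  using fragmentation_submeasureD(2)[OF assms]
  by (auto simp: fragmented_ideal_iff[OF assms])

lemma fragmented_ideal_mono:
  assumes "fragmentation a \<phi>" "y \<in> fragmented_ideal a \<phi>" "x \<subseteq> y"
  shows "x \<in> fragmented_ideal a \<phi>"
proof -
  have "\<phi> i (x \<inter> a i) \<le> \<phi> i (y \<inter> a i)" for i
    using assms(3) by (intro fragmentation_submeasureD(3)[OF assms(1)]) auto
  then show ?thesis
    using assms(2) unfolding fragmented_ideal_iff[OF assms(1)] by (meson order.trans)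
qed

lemma fragmented_ideal_Un:
  assumes "fragmentation a \<phi>" "x \<in> fragmented_ideal a \<phi>" "y \<in> fragmented_ideal a \<phi>"
  shows "x \<union> y \<in> fragmented_ideal a \<phi>"
proof -
  obtain M N where M: "\<And>i. \<phi> i (x \<inter> a i) \<le> M" and N: "\<And>i. \<phi> i (y \<inter> a i) \<le> N"
    using assms(2,3) unfolding fragmented_ideal_iff[OF assms(1)] by blast
  have "\<phi> i ((x \<union> y) \<inter> a i) \<le> M + N" for i
    using fragmentation_submeasureD(4)[OF assms(1), of "x \<inter> a i" i "y \<inter> a i"] M[of i] N[of i]
    by (simp add: Int_Un_distrib2)
  then show ?thesis
    unfolding fragmented_ideal_iff[OF assms(1)] by blast
qed

lemma infinite_unbounded_indices:
  fixes f :: "nat \<Rightarrow> real"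
  assumes "\<nexists>M. \<forall>i. f i \<le> M"
  shows "infinite {i. N \<le> f i}"
proof
  assume fin: "finite {i. N \<le> f i}"
  \<comment> \<open>Inserting \<open>N\<close> keeps the argument of \<open>Max\<close> nonempty;
    the outer \<open>max\<close> covers the indices with \<open>f i < N\<close>.\<close>
  have "f i \<le> max N (Max (insert N (f ` {i. N \<le> f i})))" for i
  proof (cases "N \<le> f i")
    case True
    then have "f i \<le> Max (insert N (f ` {i. N \<le> f i}))"
      using fin by (intro Max_ge) auto
    then show ?thesis by simp
  qed simp
  with assms show False by blast
qed

section \<open>Tallness and point masses\<close>

text \<open>Otherwise there are points of \<open>X\<close> in distinct blocks whose masses tend to
  infinity. By monotonicity, every infinite set of such points is unbounded on the blocks, which
  contradicts tallness.\<close>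

lemma tall_point_masses_bounded:
  assumes frag: "fragmentation a \<phi>"
    and tall: "tall_on X (ideal_restrict (fragmented_ideal a \<phi>) X)"
  obtains K where "0 \<le> K" "\<And>i n. n \<in> X \<inter> a i \<Longrightarrow> \<phi> i {n} \<le> K"
proof -
  define f where "f i = Max (insert 0 ((\<lambda>n. \<phi> i {n}) ` (X \<inter> a i)))" for i
  have fin: "finite (insert 0 ((\<lambda>n. \<phi> i {n}) ` (X \<inter> a i)))" for i
    using frag by (simp add: fragmentation_def)
  have le: "\<phi> i {n} \<le> f i" if "n \<in> X \<inter> a i" for i n
    using fin[of i] that unfolding f_def by (intro Max_ge) auto
  have "\<exists>M. \<forall>i. f i \<le> M"
  proof (rule ccontr)
    assume unb: "\<nexists>M. \<forall>i. f i \<le> M"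
    \<comment> \<open>The summand 1 makes the bound positive even for \<open>p = 0\<close>, so the
      default value 0 in \<open>f\<close> cannot be the maximum and a point of \<open>X\<close>
      attains it.\<close>
    obtain r where r: "inj r" "\<And>p. r p \<in> {i. real p + 1 \<le> f i}"
      using inj_choice_infinite[of "\<lambda>p. {i. real p + 1 \<le> f i}"]
        infinite_unbounded_indices[OF unb] by blast
    have "\<exists>n. n \<in> X \<inter> a (r p) \<and> real p + 1 \<le> \<phi> (r p) {n}" for p
    proof -
      have "f (r p) \<in> insert 0 ((\<lambda>n. \<phi> (r p) {n}) ` (X \<inter> a (r p)))"
        unfolding f_def using fin by (intro Max_in) auto
      moreover have "real p + 1 \<le> f (r p)" using r(2) by simp
      moreover from this have "f (r p) \<noteq> 0" by linarith
      ultimately show ?thesis by auto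
    qed
    then obtain y where y: "\<And>p. y p \<in> X \<inter> a (r p)" "\<And>p. real p + 1 \<le> \<phi> (r p) {y p}"
      by metis
    have "inj y"
    proof (rule injI)
      fix p q assume "y p = y q"
      then have "a (r p) \<inter> a (r q) \<noteq> {}" using y(1)[of p] y(1)[of q] by auto
      then show "p = q" using fragmentation_disjoint[OF frag] r(1) by (metis injD)
    qed
    then have "infinite (range y)" using finite_imageD by blast
    moreover have "range y \<subseteq> X" using y(1) by blast
    ultimately obtain Z where Z: "Z \<in> fragmented_ideal a \<phi>" "infinite Z" "Z \<subseteq> range y"
      using tall unfolding tall_on_def ideal_restrict_def by blast
    obtain M where M: "\<And>i. \<phi> i (Z \<inter> a i) \<le> M"
      using Z(1) unfolding fragmented_ideal_iff[OF frag] by blast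
    \<comment> \<open>A bound \<open>M\<close> for \<open>Z\<close> bounds the mass of each of its
      points, and \<open>y p\<close> has mass at least \<open>p + 1\<close>.\<close>
    have "Z \<subseteq> y ` {..nat \<lceil>M\<rceil>}"
    proof
      fix z assume "z \<in> Z"
      then obtain p where p: "z = y p" using Z(3) by blast
      have "\<phi> (r p) {y p} \<le> \<phi> (r p) (Z \<inter> a (r p))"
        using \<open>z \<in> Z\<close> p y(1) by (intro fragmentation_submeasureD(3)[OF frag]) auto
      then have "real p + 1 \<le> M" using y(2)[of p] M[of "r p"] by linarith
      then have "p \<le> nat \<lceil>M\<rceil>" by linarith
      then show "z \<in> y ` {..nat \<lceil>M\<rceil>}" using p by blast
    qed
    then show False using Z(2) finite_subset by blast
  qed
  then obtain M where "\<And>i. f i \<le> M" by blast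
  then have "\<phi> i {n} \<le> max 0 M" if "n \<in> X \<inter> a i" for i n
    using le[OF that] by (meson max.coboundedI2 order.trans)
  then show ?thesis by (intro that[of "max 0 M"]) auto
qed

section \<open>Measures with small point masses\<close>

lemma fin_measure_onD:
  assumes "fin_measure_on a \<phi>"
  shows "\<phi> {} = 0"
    "x \<subseteq> a \<Longrightarrow> y \<subseteq> a \<Longrightarrow> x \<inter> y = {} \<Longrightarrow> \<phi> (x \<union> y) = \<phi> x + \<phi> y"
  using assms by (simp_all add: fin_measure_on_def submeasure_on_def)

lemma fin_measure_on_UN_disjoint:
  assumes m: "fin_measure_on a \<phi>" and "finite S" "\<And>s. s \<in> S \<Longrightarrow> P s \<subseteq> a"
    and "disjoint_family_on P S"
  shows "\<phi> (\<Union>s\<in>S. P s) = (\<Sum>s\<in>S. \<phi> (P s))"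
  using assms(2-)
proof (induction S rule: finite_induct)
  case empty
  then show ?case using fin_measure_onD(1)[OF m] by simp
next
  case (insert t S)
  have "P t \<inter> (\<Union>s\<in>S. P s) = {}"
    using insert.prems(2) insert.hyps(2) by (auto simp: disjoint_family_on_def)
  then have "\<phi> (P t \<union> (\<Union>s\<in>S. P s)) = \<phi> (P t) + \<phi> (\<Union>s\<in>S. P s)"
    using insert.prems(1) by (intro fin_measure_onD(2)[OF m]) auto
  moreover have "\<phi> (\<Union>s\<in>S. P s) = (\<Sum>s\<in>S. \<phi> (P s))"
    using insert.prems by (intro insert.IH) (auto simp: disjoint_family_on_def)
  ultimately show ?case using insert.hyps by simp
qed

text \<open>A discrete intermediate value argument: when points are added one at a time, the measure
  grows by at most \<open>K\<close> per step, so the step that first reaches \<open>c\<close>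
  overshoots by at most \<open>K\<close>.\<close>

lemma fin_measure_on_intermediate:
  assumes m: "fin_measure_on a \<phi>" and "finite E" "E \<subseteq> a"
    and "\<And>n. n \<in> E \<Longrightarrow> \<phi> {n} \<le> K" and "0 \<le> c" "0 \<le> K" "c \<le> \<phi> E"
  obtains F where "F \<subseteq> E" "c \<le> \<phi> F" "\<phi> F \<le> c + K"
proof -
  have "\<exists>F\<subseteq>E. c \<le> \<phi> F \<and> \<phi> F \<le> c + K"
    using assms(2-4) assms(7)
  proof (induction E rule: finite_induct)
    case empty
    then show ?case using fin_measure_onD(1)[OF m] assms(5,6) by auto
  next
    case (insert n E)
    show ?case
    proof (cases "c \<le> \<phi> E")
      case True
      then have "\<exists>F\<subseteq>E. c \<le> \<phi> F \<and> \<phi> F \<le> c + K" using insert by simp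
      then show ?thesis by blast
    next
      case False
      have "\<phi> (insert n E) = \<phi> {n} + \<phi> E"
        using fin_measure_onD(2)[OF m, of "{n}" E] insert.prems insert.hyps by simp
      then have "\<phi> (insert n E) \<le> c + K"
        using False insert.prems(2)[of n] by simp
      then show ?thesis using insert.prems(3) by blast
    qed
  qed
  then show ?thesis using that by blast
qed

text \<open>The pieces are cut off greedily. Each uses up at most \<open>c + K\<close>, so before
  the last cut at least \<open>c + K\<close> remains, enough for one more piece.\<close>

lemma fin_measure_on_disjoint_pieces:
  assumes m: "fin_measure_on a \<phi>" and "finite E" "E \<subseteq> a"
    and K: "\<And>n. n \<in> E \<Longrightarrow> \<phi> {n} \<le> K" and "0 \<le> c" "0 \<le> K"
    and "finite S" "real (card S) * (c + K) \<le> \<phi> E"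
  obtains P where "disjoint_family_on P S" "\<And>s. s \<in> S \<Longrightarrow> P s \<subseteq> E"
    "\<And>s. s \<in> S \<Longrightarrow> c \<le> \<phi> (P s)" "\<And>s. s \<in> S \<Longrightarrow> \<phi> (P s) \<le> c + K"
proof -
  have "\<exists>P. disjoint_family_on P S \<and> (\<forall>s\<in>S. P s \<subseteq> E \<and> c \<le> \<phi> (P s) \<and> \<phi> (P s) \<le> c + K)"
    using assms(7,8)
  proof (induction S rule: finite_induct)
    case empty
    then show ?case by (auto simp: disjoint_family_on_def)
  next
    case (insert t S)
    have cardt: "real (card (insert t S)) * (c + K) = real (card S) * (c + K) + (c + K)"
      using insert.hyps by (simp add: algebra_simps)
    then have "real (card S) * (c + K) \<le> \<phi> E" using insert.prems assms(5,6) by linarith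
    then obtain P where P: "disjoint_family_on P S"
      "\<And>s. s \<in> S \<Longrightarrow> P s \<subseteq> E" "\<And>s. s \<in> S \<Longrightarrow> c \<le> \<phi> (P s)" "\<And>s. s \<in> S \<Longrightarrow> \<phi> (P s) \<le> c + K"
      using insert.IH by blast
    define U where "U = (\<Union>s\<in>S. P s)"
    have "\<phi> U = (\<Sum>s\<in>S. \<phi> (P s))"
      unfolding U_def using P(1,2) insert.hyps(1) assms(3)
      by (intro fin_measure_on_UN_disjoint[OF m]) auto
    also have "\<dots> \<le> real (card S) * (c + K)"
      using P(4) by (rule sum_bounded_above)
    finally have U: "\<phi> U \<le> real (card S) * (c + K)" .
    have "U \<subseteq> E" using P(2) by (auto simp: U_def)
    then have "\<phi> E = \<phi> U + \<phi> (E - U)"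
      using fin_measure_onD(2)[OF m, of U "E - U"] assms(3) by (auto simp: Un_absorb1)
    then have "c \<le> \<phi> (E - U)" using U cardt insert.prems assms(6) by linarith
    then obtain F where F: "F \<subseteq> E - U" "c \<le> \<phi> F" "\<phi> F \<le> c + K"
      using fin_measure_on_intermediate[OF m, of "E - U" K c] assms(2,3,5,6) K by auto
    have "disjoint_family_on (P(t := F)) (insert t S)"
      using P(1) F(1) insert.hyps(2) by (fastforce simp: disjoint_family_on_def U_def)
    moreover have "\<forall>s\<in>insert t S. (P(t := F)) s \<subseteq> E \<and> c \<le> \<phi> ((P(t := F)) s)
        \<and> \<phi> ((P(t := F)) s) \<le> c + K"
      using P F by auto
    ultimately show ?case by blast
  qed
  then show ?thesis using that by blast
qed

section \<open>Failure of gradual fragmentation\<close>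

text \<open>The bound \<open>m\<close> must be fixed before \<open>l\<close>, so
  \<open>l = m + 1\<close> may be taken: \<open>m + 1\<close> disjoint pieces of measure between 1
  and \<open>1 + K\<close> have a union of measure above \<open>m\<close>.\<close>

lemma not_gradually_fragmented:
  assumes frag: "fragmentation a \<phi>" and meas: "\<And>j. fin_measure_on (a j) (\<phi> j)"
    and X: "X \<notin> fragmented_ideal a \<phi>"
    and K: "0 \<le> K" "\<And>i n. n \<in> X \<inter> a i \<Longrightarrow> \<phi> i {n} \<le> K"
  shows "\<not> gradually_fragmented a \<phi>"
proof
  assume "gradually_fragmented a \<phi>"
  then obtain m :: nat where m: "\<And>l::nat. \<forall>\<^sub>\<infinity>i. \<forall>B. B \<subseteq> Pow (a i) \<and> card B \<le> l \<and>
      (\<forall>b\<in>B. \<phi> i b \<le> real (nat \<lceil>1 + K\<rceil>)) \<longrightarrow> \<phi> i (\<Union>B) \<le> real m"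
    unfolding gradually_fragmented_def by blast
  have "\<exists>\<^sub>\<infinity>i. real (m + 1) * (1 + K) \<le> \<phi> i (X \<inter> a i)"
    using X infinite_unbounded_indices[of "\<lambda>i. \<phi> i (X \<inter> a i)"]
    unfolding frequently_cofinite fragmented_ideal_iff[OF frag] by blast
  \<comment> \<open>Infinitely many blocks are large and the fragmentation bound fails on only
    finitely many, so some block has both properties.\<close>
  from frequently_eventually_frequently[OF this m[of "m + 1"]]
  obtain i where i: "real (m + 1) * (1 + K) \<le> \<phi> i (X \<inter> a i)"
    and B: "\<And>B. B \<subseteq> Pow (a i) \<Longrightarrow> card B \<le> m + 1 \<Longrightarrow>
      (\<And>b. b \<in> B \<Longrightarrow> \<phi> i b \<le> real (nat \<lceil>1 + K\<rceil>)) \<Longrightarrow> \<phi> i (\<Union>B) \<le> real m"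
    by (auto dest!: frequently_ex)
  have "finite (X \<inter> a i)" using frag by (simp add: fragmentation_def)
  then obtain P where P: "disjoint_family_on P {..<m + 1}"
    "\<And>s. s \<in> {..<m + 1} \<Longrightarrow> P s \<subseteq> X \<inter> a i"
    "\<And>s. s \<in> {..<m + 1} \<Longrightarrow> 1 \<le> \<phi> i (P s)" "\<And>s. s \<in> {..<m + 1} \<Longrightarrow> \<phi> i (P s) \<le> 1 + K"
    by (rule fin_measure_on_disjoint_pieces[OF meas, of "X \<inter> a i" i K 1 "{..<m + 1}"])
      (use K i in auto)
  have "\<phi> i (\<Union>(P ` {..<m + 1})) \<le> real m"
  proof (rule B)
    show "P ` {..<m + 1} \<subseteq> Pow (a i)" using P(2) by blast
    show "card (P ` {..<m + 1}) \<le> m + 1"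
      using card_image_le[of "{..<m + 1}" P] by simp
    show "\<phi> i b \<le> real (nat \<lceil>1 + K\<rceil>)" if "b \<in> P ` {..<m + 1}" for b
      using that P(4) real_nat_ceiling_ge[of "1 + K"] by force
  qed
  moreover have "\<phi> i (\<Union>(P ` {..<m + 1})) = (\<Sum>s<m + 1. \<phi> i (P s))"
    using P by (intro fin_measure_on_UN_disjoint[OF meas]) auto
  moreover have "real (card {..<m + 1}) * 1 \<le> (\<Sum>s<m + 1. \<phi> i (P s))"
    using P(3) by (rule sum_bounded_below)
  ultimately show False by simp
qed

section \<open>Countable families and cardinality\<close>

lemma countable_orthogonal_separated:
  fixes J :: "'a set set"
  assumes empty: "{} \<in> J" and mono: "\<And>x y. y \<in> J \<Longrightarrow> x \<subseteq> y \<Longrightarrow> x \<in> J"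
    and Un: "\<And>x y. x \<in> J \<Longrightarrow> y \<in> J \<Longrightarrow> x \<union> y \<in> J"
    and orth: "orthogonal_mod J \<A> \<B>" and "countable \<A>" "countable \<B>"
  shows "\<exists>C. separates_mod J C \<A> \<B>"
\<comment> \<open>Empty families are treated apart because \<open>from_nat_into\<close> enumerates
  only nonempty ones.\<close>
proof (cases "\<A> = {} \<or> \<B> = {}")
  case True
  then show ?thesis
  proof
    assume "\<A> = {}"
    then have "separates_mod J UNIV \<A> \<B>"
      using empty by (simp add: separates_mod_def subset_mod_def)
    then show ?thesis ..
  next
    assume "\<B> = {}"
    then have "separates_mod J {} \<A> \<B>"
      using empty by (simp add: separates_mod_def)
    then show ?thesis ..
  qed
next
  case False
  define A where "A = from_nat_into \<A>"
  define B where "B = from_nat_into \<B>"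
  have ran: "range A = \<A>" "range B = \<B>"
    unfolding A_def B_def using False assms(5,6) by (simp_all add: range_from_nat_into)
  have AB: "A m \<inter> B n \<in> J" for m n
    using orth ran unfolding orthogonal_mod_def by blast
  have UN: "(\<Union>s\<in>S. f s) \<in> J" if "finite S" "\<And>s. f s \<in> J" for S :: "nat set" and f
    using that by (induction S rule: finite_induct) (auto intro: empty Un)
  \<comment> \<open>The usual diagonal separator: \<open>A m\<close> meets only the contributions of
    \<open>B n\<close> with \<open>n < m\<close>, and \<open>B n\<close> loses only its
    intersections with \<open>A m\<close> for \<open>m \<le> n\<close>. Both are finite unions of
    members of \<open>J\<close>.\<close>
  define C where "C = (\<Union>n. B n - (\<Union>m\<le>n. A m))"
  have "A m \<inter> C \<in> J" for m
  proof (rule mono)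
    show "(\<Union>n<m. A m \<inter> B n) \<in> J" by (rule UN) (auto intro: AB)
    show "A m \<inter> C \<subseteq> (\<Union>n<m. A m \<inter> B n)"
      unfolding C_def by (auto simp: Bex_def) (metis not_le)
  qed
  moreover have "B n - C \<in> J" for n
  proof (rule mono)
    show "(\<Union>m\<le>n. A m \<inter> B n) \<in> J" by (rule UN) (auto intro: AB)
    show "B n - C \<subseteq> (\<Union>m\<le>n. A m \<inter> B n)" unfolding C_def by auto
  qed
  ultimately have "separates_mod J C \<A> \<B>"
    unfolding separates_mod_def subset_mod_def ran[symmetric] by blast
  then show ?thesis ..
qed

text \<open>By Cantor's theorem the power set of the naturals has size at least aleph-1. The family
  \<open>R\<close> will index one side of the gap.\<close>

lemma ex_nat_sets_card_aleph1:
  obtains R :: "nat set set" where "|R| =o cardSuc natLeq"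
proof -
  have "natLeq <o |UNIV :: nat set set|"
    using ordIso_ordLess_trans[OF ordIso_symmetric[OF card_of_nat] card_of_Pow[of "UNIV :: nat set"]]
    by simp
  then have le: "cardSuc natLeq \<le>o |UNIV :: nat set set|"
    by (intro cardSuc_least natLeq_Card_order card_of_Card_order)
  have iso: "|Field (cardSuc natLeq)| =o cardSuc natLeq"
    by (intro card_of_Field_ordIso cardSuc_Card_order natLeq_Card_order)
  have "|Field (cardSuc natLeq)| \<le>o |UNIV :: nat set set|"
    using ordIso_ordLeq_trans[OF iso le] .
  then obtain R :: "nat set set" where "|Field (cardSuc natLeq)| =o |R|"
    using internalize_card_of_ordLeq[THEN iffD1] by blast
  then have "|R| =o cardSuc natLeq"
    using iso ordIso_symmetric ordIso_transitive by blast
  then show ?thesis using that by blast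
qed

lemma countable_iff_card_of_ordLeq_natLeq: "countable S \<longleftrightarrow> |S| \<le>o natLeq"
proof -
  have "countable S \<longleftrightarrow> |S| \<le>o |UNIV :: nat set|"
    unfolding countable_def card_of_ordLeq[symmetric] by simp
  also have "\<dots> \<longleftrightarrow> |S| \<le>o natLeq"
    using card_of_nat ordIso_symmetric ordLeq_ordIso_trans by blast
  finally show ?thesis .
qed

text \<open>Turns the minimality clause of \<open>is_bb\<close> into a statement about
  countability.\<close>

lemma uncountable_iff_cardSuc_ordLeq: "uncountable S \<longleftrightarrow> cardSuc natLeq \<le>o |S|"
  unfolding countable_iff_card_of_ordLeq_natLeq
    cardSuc_ordLess_ordLeq[OF natLeq_Card_order card_of_Card_order, symmetric]
  by (rule not_ordLeq_iff_ordLess[OF natLeq_Well_order card_of_Well_order])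

section \<open>A gap of size aleph-1\<close>

lemma finite_nat_sets_eventually_distinguished:
  fixes T :: "nat set set"
  assumes "finite T"
  obtains j where "inj_on (\<lambda>x. x \<inter> {..<j}) T"
proof -
  have "\<exists>k. x \<noteq> y \<longrightarrow> (k \<in> x) \<noteq> (k \<in> y)" for x y :: "nat set" by blast
  then obtain k where k: "\<And>x y :: nat set. x \<noteq> y \<Longrightarrow> (k x y \<in> x) \<noteq> (k x y \<in> y)" by metis
  \<comment> \<open>\<open>Suc\<close> puts every distinguishing point strictly below
    \<open>j\<close>; the inserted 0 serves the case of empty \<open>T\<close>.\<close>
  define j where "j = Suc (Max (insert 0 ((\<lambda>(x, y). k x y) ` (T \<times> T))))"
  have kj: "k x y < j" if "x \<in> T" "y \<in> T" for x y
    unfolding j_def less_Suc_eq_le using assms that by (intro Max_ge) auto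
  have "inj_on (\<lambda>x. x \<inter> {..<j}) T"
  proof (rule inj_onI, rule ccontr)
    fix x y assume "x \<in> T" "y \<in> T" "x \<inter> {..<j} = y \<inter> {..<j}" "x \<noteq> y"
    then show False using k[of x y] kj[of x y] by blast
  qed
  then show ?thesis using that by blast
qed

lemma ex_gap_aleph1:
  assumes frag: "fragmentation a \<phi>" and meas: "\<And>j. fin_measure_on (a j) (\<phi> j)"
    and X: "X \<notin> fragmented_ideal a \<phi>"
    and K: "0 \<le> K" "\<And>i n. n \<in> X \<inter> a i \<Longrightarrow> \<phi> i {n} \<le> K"
  shows "\<exists>\<A> \<B>. gap_mod (fragmented_ideal a \<phi>) \<A> \<B> \<and> |\<A>| =o natLeq \<and> |\<B>| =o cardSuc natLeq"
proof -
  \<comment> \<open>The measure that suffices to cut out one piece for each subset of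
    \<open>{..<j}\<close>, with \<open>c = n + 1\<close>.\<close>
  define N where "N n j = real (card (Pow {..<j})) * ((real n + 1) + K)" for n j :: nat
  define S where "S p = {i. (\<lambda>(n, j). N n j) (prod_decode p) \<le> \<phi> i (X \<inter> a i)}" for p
  have "infinite (S p)" for p
    using X unfolding S_def fragmented_ideal_iff[OF frag] by (rule infinite_unbounded_indices)
  then obtain r where r: "inj r" "\<And>p. r p \<in> S p" using inj_choice_infinite by metis
  define ix where "ix n j = r (prod_encode (n, j))" for n j
  have ix_inj: "ix n j = ix n' j' \<longleftrightarrow> n = n' \<and> j = j'" for n j n' j'
    unfolding ix_def using r(1) by (auto simp: inj_eq)
  have ix: "N n j \<le> \<phi> (ix n j) (X \<inter> a (ix n j))" for n j
    using r(2)[of "prod_encode (n, j)"] by (simp add: S_def ix_def)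
  have "\<exists>P. disjoint_family_on P (Pow {..<j}) \<and> (\<forall>s\<in>Pow {..<j}. P s \<subseteq> a (ix n j) \<and>
      real n + 1 \<le> \<phi> (ix n j) (P s) \<and> \<phi> (ix n j) (P s) \<le> real n + 1 + K)" for n j
  proof -
    have "finite (X \<inter> a (ix n j))" using frag by (simp add: fragmentation_def)
    then obtain P where P: "disjoint_family_on P (Pow {..<j})"
      "\<And>s. s \<in> Pow {..<j} \<Longrightarrow> P s \<subseteq> X \<inter> a (ix n j)"
      "\<And>s. s \<in> Pow {..<j} \<Longrightarrow> real n + 1 \<le> \<phi> (ix n j) (P s)"
      "\<And>s. s \<in> Pow {..<j} \<Longrightarrow> \<phi> (ix n j) (P s) \<le> real n + 1 + K"
      by (rule fin_measure_on_disjoint_pieces[OF meas[of "ix n j"], of "X \<inter> a (ix n j)" K "real n + 1"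
          "Pow {..<j}"]) (use K ix[of n j, unfolded N_def] in auto)
    then show ?thesis by blast
  qed
  then have "\<exists>P. \<forall>n j. disjoint_family_on (P n j) (Pow {..<j}) \<and> (\<forall>s\<in>Pow {..<j}.
      P n j s \<subseteq> a (ix n j) \<and> real n + 1 \<le> \<phi> (ix n j) (P n j s) \<and>
      \<phi> (ix n j) (P n j s) \<le> real n + 1 + K)"
    by (intro choice allI)
  then obtain P where P_all: "\<And>n j. disjoint_family_on (P n j) (Pow {..<j})"
      "\<And>n j. \<forall>s\<in>Pow {..<j}. P n j s \<subseteq> a (ix n j) \<and> real n + 1 \<le> \<phi> (ix n j) (P n j s) \<and>
        \<phi> (ix n j) (P n j s) \<le> real n + 1 + K"
    by blast
  have P: "P n j s \<subseteq> a (ix n j)" "real n + 1 \<le> \<phi> (ix n j) (P n j s)"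
    "\<phi> (ix n j) (P n j s) \<le> real n + 1 + K" if "s \<subseteq> {..<j}" for n j s
    using P_all(2)[of j n] that by (simp_all add: Ball_def)
  define A where "A n = (\<Union>j. a (ix n j))" for n
  define B where "B x = (\<Union>n j. P n j (x \<inter> {..<j}))" for x :: "nat set"
  have a_ix: "a (ix n j) \<inter> a i = {}" if "i \<noteq> ix n j" for n j i
    using fragmentation_disjoint[OF frag] that by blast
  \<comment> \<open>Distinct pairs give disjoint blocks, so only the piece with index
    \<open>(n, j)\<close> survives.\<close>
  have B_block: "B x \<inter> a (ix n j) = P n j (x \<inter> {..<j})" for x n j
  proof
    show "P n j (x \<inter> {..<j}) \<subseteq> B x \<inter> a (ix n j)" using P(1) unfolding B_def by blast
    have "P n' j' (x \<inter> {..<j'}) \<inter> a (ix n j) = {}" if "\<not> (n' = n \<and> j' = j)" for n' j'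
    proof -
      have "a (ix n' j') \<inter> a (ix n j) = {}" using that by (intro a_ix) (auto simp: ix_inj)
      then show ?thesis using P(1)[of "x \<inter> {..<j'}" j' n'] by blast
    qed
    then show "B x \<inter> a (ix n j) \<subseteq> P n j (x \<inter> {..<j})" unfolding B_def by fastforce
  qed
  have P_disj: "P n j s \<inter> P n j t = {}" if "s \<noteq> t" "s \<subseteq> {..<j}" "t \<subseteq> {..<j}" for n j s t
    using P_all(1)[of n j] that unfolding disjoint_family_on_def by blast
  have P_ne: "P n j s \<noteq> {}" if "s \<subseteq> {..<j}" for n j s
    using P(2)[OF that, of n] fragmentation_submeasureD(2)[OF frag] by auto
  have "inj A"
  proof (rule injI, rule ccontr)
    fix n m assume "A n = A m" "n \<noteq> m"
    obtain z where "z \<in> a (ix n 0)" using frag unfolding fragmentation_def by blast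
    then obtain j where "z \<in> a (ix m j)" using \<open>A n = A m\<close> unfolding A_def by blast
    moreover have "a (ix n 0) \<inter> a (ix m j) = {}"
      using \<open>n \<noteq> m\<close> by (intro a_ix) (auto simp: ix_inj)
    ultimately show False using \<open>z \<in> a (ix n 0)\<close> by blast
  qed
  have "inj B"
  proof (rule injI, rule ccontr)
    fix x y assume "B x = B y" "x \<noteq> y"
    obtain j where "inj_on (\<lambda>z. z \<inter> {..<j}) {x, y}"
      using finite_nat_sets_eventually_distinguished[of "{x, y}"] by auto
    then have "x \<inter> {..<j} \<noteq> y \<inter> {..<j}" using \<open>x \<noteq> y\<close> by (auto simp: inj_on_def)
    moreover have "P 0 j (x \<inter> {..<j}) = P 0 j (y \<inter> {..<j})"
      using B_block[of x 0 j] B_block[of y 0 j] \<open>B x = B y\<close> by simp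
    ultimately show False using P_disj[of "x \<inter> {..<j}" "y \<inter> {..<j}" j 0] P_ne[of "x \<inter> {..<j}" j 0] by simp
  qed
  obtain R :: "nat set set" where R: "|R| =o cardSuc natLeq" by (rule ex_nat_sets_card_aleph1)
  have "uncountable R"
    unfolding uncountable_iff_cardSuc_ordLeq using R ordIso_imp_ordLeq ordIso_symmetric by blast
  have orth: "A n \<inter> B x \<in> fragmented_ideal a \<phi>" for n x
  proof -
    \<comment> \<open>The bound depends on \<open>n\<close> alone: within \<open>A n\<close>, each
      block contains a single piece of \<open>B x\<close>.\<close>
    have "\<phi> i (A n \<inter> B x \<inter> a i) \<le> real n + 1 + K" for i
    proof (cases "\<exists>j. i = ix n j")
      case True
      then obtain j where i: "i = ix n j" by blast
      have "\<phi> i (A n \<inter> B x \<inter> a i) \<le> \<phi> i (P n j (x \<inter> {..<j}))"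
        using B_block[of x n j] P(1)[of "x \<inter> {..<j}" j n] i
        by (intro fragmentation_submeasureD(3)[OF frag]) auto
      also have "\<dots> \<le> real n + 1 + K" unfolding i by (rule P(3)) simp
      finally show ?thesis .
    next
      case False
      then have "A n \<inter> a i = {}" unfolding A_def using a_ix by blast
      then have "A n \<inter> B x \<inter> a i = {}" by blast
      then show ?thesis using fragmentation_submeasureD(2)[OF frag] K(1) by simp
    qed
    then show ?thesis unfolding fragmented_ideal_iff[OF frag] by blast
  qed
  have "\<not> separates_mod (fragmented_ideal a \<phi>) C (range A) (B ` R)" for C
  proof
    assume sep: "separates_mod (fragmented_ideal a \<phi>) C (range A) (B ` R)"
    \<comment> \<open>Countably many integer bounds cover the uncountable \<open>R\<close>, so one
      \<open>D d\<close> is infinite.\<close>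
    define D where "D d = {x \<in> R. \<forall>i. \<phi> i ((B x - C) \<inter> a i) \<le> real d}" for d :: nat
    have "R \<subseteq> (\<Union>d. D d)"
    proof
      fix x assume "x \<in> R"
      then have "B x - C \<in> fragmented_ideal a \<phi>"
        using sep unfolding separates_mod_def subset_mod_def by blast
      then obtain M where M: "\<And>i. \<phi> i ((B x - C) \<inter> a i) \<le> M"
        unfolding fragmented_ideal_iff[OF frag] by blast
      obtain d :: nat where "M \<le> real d" using real_arch_simple by blast
      then have "\<phi> i ((B x - C) \<inter> a i) \<le> real d" for i using M[of i] by linarith
      then show "x \<in> (\<Union>d. D d)" using \<open>x \<in> R\<close> unfolding D_def by blast
    qed
    then have "\<exists>d. infinite (D d)"
      using \<open>uncountable R\<close> countable_subset[of R "\<Union>d. D d"]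
      by (meson countableI_type countable_UN countable_finite)
    then obtain d where d: "infinite (D d)" by blast
    have "A d \<inter> C \<in> fragmented_ideal a \<phi>" using sep unfolding separates_mod_def by blast
    then obtain g where g: "\<And>i. \<phi> i (A d \<inter> C \<inter> a i) \<le> g"
      unfolding fragmented_ideal_iff[OF frag] by blast
    \<comment> \<open>More than \<open>g\<close> disjoint pieces, each meeting \<open>C\<close> in
      measure at least 1, will exceed the bound \<open>g\<close>.\<close>
    obtain t :: nat where t: "g < real t" using reals_Archimedean2 by blast
    obtain T where T: "T \<subseteq> D d" "finite T" "card T = t"
      using infinite_arbitrarily_large[OF d] by blast
    obtain j where j: "inj_on (\<lambda>x. x \<inter> {..<j}) T"
      using finite_nat_sets_eventually_distinguished[OF T(2)] by blast
    define i where "i = ix d j"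
    define Q where "Q x = B x \<inter> a i \<inter> C" for x
    \<comment> \<open>In the blocks of \<open>A d\<close> the pieces have measure at least
      \<open>d + 1\<close>, and at most \<open>d\<close> of it lies outside
      \<open>C\<close>.\<close>
    have Q: "1 \<le> \<phi> i (Q x)" if "x \<in> T" for x
    proof -
      have "\<phi> i ((B x \<inter> a i \<inter> C) \<union> ((B x - C) \<inter> a i)) = \<phi> i (Q x) + \<phi> i ((B x - C) \<inter> a i)"
        unfolding Q_def by (intro fin_measure_onD(2)[OF meas]) auto
      moreover have "(B x \<inter> a i \<inter> C) \<union> ((B x - C) \<inter> a i) = P d j (x \<inter> {..<j})"
        unfolding B_block[symmetric] i_def by blast
      moreover have "real d + 1 \<le> \<phi> i (P d j (x \<inter> {..<j}))" unfolding i_def by (rule P(2)) simp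
      moreover have "\<phi> i ((B x - C) \<inter> a i) \<le> real d" using that T(1) unfolding D_def by blast
      ultimately show ?thesis by simp
    qed
    have "real (card T) * 1 \<le> (\<Sum>x\<in>T. \<phi> i (Q x))" using Q by (rule sum_bounded_below)
    also have "\<dots> = \<phi> i (\<Union>x\<in>T. Q x)"
    proof (rule fin_measure_on_UN_disjoint[OF meas T(2), symmetric])
      show "Q x \<subseteq> a i" for x unfolding Q_def by blast
      show "disjoint_family_on Q T"
        unfolding disjoint_family_on_def
      proof (intro ballI impI)
        fix x y assume "x \<in> T" "y \<in> T" "x \<noteq> y"
        then have "x \<inter> {..<j} \<noteq> y \<inter> {..<j}" using j by (auto simp: inj_on_def)
        then have "P d j (x \<inter> {..<j}) \<inter> P d j (y \<inter> {..<j}) = {}" by (intro P_disj) auto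
        then show "Q x \<inter> Q y = {}" unfolding Q_def i_def B_block by blast
      qed
    qed
    also have "\<dots> \<le> \<phi> i (A d \<inter> C \<inter> a i)"
      unfolding Q_def A_def i_def by (intro fragmentation_submeasureD(3)[OF frag]) auto
    also have "\<dots> \<le> g" by (rule g)
    finally show False using t T(3) by simp
  qed
  moreover have "orthogonal_mod (fragmented_ideal a \<phi>) (range A) (B ` R)"
    unfolding orthogonal_mod_def using orth by blast
  ultimately have "gap_mod (fragmented_ideal a \<phi>) (range A) (B ` R)"
    unfolding gap_mod_def by blast
  moreover have "|range A| =o natLeq"
    using ordIso_transitive[OF ordIso_symmetric[OF card_of_ordIsoI[OF inj_on_imp_bij_betw]] card_of_nat]
      \<open>inj A\<close> .
  moreover have "|B ` R| =o cardSuc natLeq"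
    using ordIso_transitive[OF ordIso_symmetric[OF card_of_ordIsoI[OF inj_on_imp_bij_betw]] R]
      inj_on_subset[OF \<open>inj B\<close> subset_UNIV] .
  ultimately show ?thesis by blast
qed

theorem theorem3p6:
  fixes a :: "nat \<Rightarrow> nat set" and \<phi> :: "nat \<Rightarrow> nat set \<Rightarrow> real"
  assumes "fragmentation a \<phi>"
    and "somewhere_tall (fragmented_ideal a \<phi>)"
    and "\<And>j. fin_measure_on (a j) (\<phi> j)"
  shows "\<not> gradually_fragmented a \<phi> \<and> is_bb (fragmented_ideal a \<phi>) (cardSuc natLeq)"
proof -
  let ?I = "fragmented_ideal a \<phi>"
  obtain X where X: "X \<notin> ?I" "tall_on X (ideal_restrict ?I X)"
    using assms(2) unfolding somewhere_tall_def by blast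
  obtain K where K: "0 \<le> K" "\<And>i n. n \<in> X \<inter> a i \<Longrightarrow> \<phi> i {n} \<le> K"
    using tall_point_masses_bounded[OF assms(1) X(2)] by blast
  \<comment> \<open>A gap with countable \<open>\<A>\<close> cannot have countable
    \<open>\<B>\<close>, since such a pair would be separated.\<close>
  have "cardSuc natLeq \<le>o |\<B>|" if "gap_mod ?I \<A> \<B>" "|\<A>| =o natLeq" for \<A> \<B>
  proof -
    have "countable \<A>"
      unfolding countable_iff_card_of_ordLeq_natLeq using that(2) by (rule ordIso_imp_ordLeq)
    then have "uncountable \<B>"
      using that(1) countable_orthogonal_separated[of ?I \<A> \<B>] fragmented_ideal_empty[OF assms(1)]
        fragmented_ideal_mono[OF assms(1)] fragmented_ideal_Un[OF assms(1)]
      unfolding gap_mod_def by blast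
    then show ?thesis by (simp add: uncountable_iff_cardSuc_ordLeq)
  qed
  then have "is_bb ?I (cardSuc natLeq)"
    unfolding is_bb_def
    using ex_gap_aleph1[OF assms(1,3) X(1) K] cardSuc_Card_order[OF natLeq_Card_order] by blast
  then show ?thesis using not_gradually_fragmented[OF assms(1,3) X(1) K] by blast
qed

end
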